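(* Let $P(X)\in\mathbb{Z}[X]$ be a polynomial of degree $d$, and assume $d\ge 2$. If $\tau>d+1$, then $$W_{\tau}(P_{\alpha})=\emptyset$$ for almost all $\alpha\in\mathbb{R}$ (with respect to Lebesgue measure).
   Context: For a real number $\alpha$ and $\tau>0$, $W_{\tau}(P_{\alpha})$ denotes the set of all $x\in\mathbb{R}$ such that $$\left|x-\frac{p}{q}\right|<\frac{1}{q^{\tau}}\quad\text{and}\quad\left|P(x)+\alpha-\frac{r}{q}\right|<\frac{1}{q^{\tau}}$$ for infinitely many triples of integers $(p,r,q)$ with $q\ge 1$. "Almost all" means that the set of exceptions has Lebesgue measure zero. *)

theory Defs
  imports "HOL-Analysis.Analysis" "HOL-Computational_Algebra.Polynomial"
begin

(* W tau P alpha is the set written W_tau(P_alpha), where P_alpha = P + alpha.  The triples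
   (p, r, q) are not required to be coprime. *)
definition W :: "real \<Rightarrow> int poly \<Rightarrow> real \<Rightarrow> real set" where
  "W \<tau> P \<alpha> = {x. infinite {(p :: int, r :: int, q :: int). q \<ge> 1 \<and>
     \<bar>x - real_of_int p / real_of_int q\<bar> < 1 / real_of_int q powr \<tau> \<and>
     \<bar>poly (map_poly real_of_int P) x + \<alpha> - real_of_int r / real_of_int q\<bar>
       < 1 / real_of_int q powr \<tau>}}"

end

theory Submission
  imports Defs
begin

text \<open>If \<open>x\<close> and \<open>\<alpha>\<close> are bounded and \<open>(p, r, q)\<close> is a solution, then the Lipschitz
  continuity of the polynomial puts \<open>\<alpha>\<close> within \<open>O(q powr -\<tau>)\<close> of \<open>r/q - P(p/q)\<close>. Only
  \<open>O(q\<^sup>2)\<close> pairs \<open>(p, r)\<close> are relevant for a given \<open>q\<close>, so the exceptional \<open>\<alpha>\<close> at level \<open>q\<close>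
  form a set of measure \<open>O(q powr (2 - \<tau>))\<close>. Since \<open>\<tau> > d + 1 \<ge> 3\<close> this is summable, and the
  Borel--Cantelli lemma applies.\<close>

lemma measure_lborel_Union_ball_le:
  fixes c :: "'i \<Rightarrow> real"
  assumes "finite I" and "0 \<le> e"
  shows "measure lborel (\<Union>i\<in>I. ball (c i) e) \<le> real (card I) * (2 * e)"
proof -
  have "measure lborel (\<Union>i\<in>I. ball (c i) e) \<le> (\<Sum>i\<in>I. measure lborel (ball (c i) e))"
    using assms by (intro measure_UNION_le) auto
  also have "\<dots> = real (card I) * (2 * e)"
    using assms(2) by (simp add: ball_eq_greaterThanLessThan)
  finally show ?thesis .
qed

text \<open>A side has \<open>2 * (m * n) + 1\<close> points, at most \<open>3 * (m * n)\<close>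
  because \<open>m * n\<close> is at least 1; squaring gives the factor 9. Here \<open>n\<close>
  will be the denominator and \<open>m\<close> a bound for the two fractions.\<close>

lemma card_lattice_box_le:
  fixes m n :: nat
  assumes "1 \<le> m" and "1 \<le> n"
  shows "real (card ({- int (m * n)..int (m * n)} \<times> {- int (m * n)..int (m * n)}))
    \<le> 9 * (real m)\<^sup>2 * (real n)\<^sup>2"
proof -
  have "1 * 1 \<le> m * n" using assms by (intro mult_mono) auto
  then have "2 * (m * n) + 1 \<le> 3 * (m * n)" by linarith
  moreover have "card ({- int (m * n)..int (m * n)} \<times> {- int (m * n)..int (m * n)})
      = (2 * (m * n) + 1) * (2 * (m * n) + 1)"
  proof -
    have "nat (int (m * n) - - int (m * n) + 1) = 2 * (m * n) + 1" by linarith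
    then show ?thesis by (simp only: card_cartesian_product card_atLeastAtMost_int)
  qed
  ultimately have "card ({- int (m * n)..int (m * n)} \<times> {- int (m * n)..int (m * n)})
      \<le> (3 * (m * n)) * (3 * (m * n))"
    by (metis mult_mono zero_le)
  then have "real (card ({- int (m * n)..int (m * n)} \<times> {- int (m * n)..int (m * n)}))
      \<le> real ((3 * (m * n)) * (3 * (m * n)))"
    by (rule of_nat_mono)
  then show ?thesis by (simp add: power2_eq_square algebra_simps)
qed

text \<open>This is the measure-theoretic half. For each \<open>q\<close> the function
  \<open>f\<close> enters only through its values at finitely many rationals, which merely shift the
  centres of the intervals, so no regularity of \<open>f\<close> matters for the measure
  estimate.\<close>

lemma AE_eventually_not_near_lattice_differences:
  fixes f :: "real \<Rightarrow> real" and \<tau> C :: real and M :: nat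
  assumes "3 < \<tau>" and "1 \<le> M" and "0 \<le> C"
  shows "AE \<alpha> in lborel. \<forall>\<^sub>F q :: nat in sequentially.
    \<forall>p\<in>{- int (M * q)..int (M * q)}. \<forall>r\<in>{- int (M * q)..int (M * q)}.
      C * real q powr - \<tau> \<le> \<bar>\<alpha> - (real_of_int r / real q - f (real_of_int p / real q))\<bar>"
proof -
  define I where "I q = {- int (M * q)..int (M * q)} \<times> {- int (M * q)..int (M * q)}" for q
  define c where
    "c q = (\<lambda>(p, r). real_of_int r / real q - f (real_of_int p / real q))" for q :: nat
  define E where "E q = (\<Union>i\<in>I q. ball (c q i) (C * real q powr - \<tau>))" for q :: nat
  have fin: "finite (I q)" for q by (simp add: I_def)
  have sets: "E q \<in> sets lborel" for q
    unfolding E_def using fin by auto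
  \<comment> \<open>\<open>measure\<close> is 0 on sets of infinite measure, so Borel-Cantelli
    stated with \<open>measure\<close> asks for finiteness separately.\<close>
  have finite_measure: "emeasure lborel (E q) < \<infinity>" for q
  proof -
    have "bounded (E q)" unfolding E_def using fin by auto
    then show ?thesis by (rule emeasure_bounded_finite)
  qed
  have bound: "measure lborel (E q) \<le> 18 * (real M)\<^sup>2 * C * real q powr (2 - \<tau>)" for q
  \<comment> \<open>The lattice count needs a positive \<open>q\<close>. For \<open>q = 0\<close>
    the convention \<open>0 powr a = 0\<close> makes every radius 0, so the balls are empty.\<close>
  proof (cases "q = 0")
    case True
    then show ?thesis by (simp add: E_def)
  next
    case False
    have "measure lborel (E q) \<le> real (card (I q)) * (2 * (C * real q powr - \<tau>))"
      unfolding E_def using fin assms by (intro measure_lborel_Union_ball_le) auto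
    also have "\<dots> \<le> (9 * (real M)\<^sup>2 * (real q)\<^sup>2) * (2 * (C * real q powr - \<tau>))"
      unfolding I_def using assms False by (intro mult_right_mono card_lattice_box_le) auto
    also have "\<dots> = 18 * (real M)\<^sup>2 * C * ((real q)\<^sup>2 * real q powr - \<tau>)"
      by (simp add: algebra_simps)
    also have "(real q)\<^sup>2 * real q powr - \<tau> = real q powr (2 - \<tau>)"
      using False by (simp add: powr_diff powr_minus_divide)
    finally show ?thesis .
  qed
  \<comment> \<open>The series converges since \<open>3 < \<tau>\<close> means that the exponent is
    below -1.\<close>
  have "summable (\<lambda>q. 18 * (real M)\<^sup>2 * C * real q powr (2 - \<tau>))"
    using assms by (intro summable_mult) (simp add: summable_real_powr_iff)
  then have "summable (\<lambda>q. measure lborel (E q))"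
    by (rule summable_comparison_test') (use bound in auto)
  then have bc: "AE \<alpha> in lborel. \<forall>\<^sub>F q in sequentially. \<alpha> \<in> space lborel - E q"
    by (intro borel_cantelli_AE1 sets finite_measure)
  have near: "C * real q powr - \<tau>
        \<le> \<bar>\<alpha> - (real_of_int r / real q - f (real_of_int p / real q))\<bar>"
    if "\<alpha> \<notin> E q" "p \<in> {- int (M * q)..int (M * q)}" "r \<in> {- int (M * q)..int (M * q)}"
    for \<alpha> p r and q :: nat
  proof -
    have "\<alpha> \<notin> ball (c q (p, r)) (C * real q powr - \<tau>)"
      using that unfolding E_def I_def by blast
    then show ?thesis by (simp add: c_def dist_commute dist_real_def)
  qed
  from bc show ?thesis
  proof (rule AE_mp, intro AE_I2 impI)
    fix \<alpha> :: real
    assume "\<forall>\<^sub>F q in sequentially. \<alpha> \<in> space lborel - E q"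
    then show "\<forall>\<^sub>F q :: nat in sequentially.
      \<forall>p\<in>{- int (M * q)..int (M * q)}. \<forall>r\<in>{- int (M * q)..int (M * q)}.
        C * real q powr - \<tau> \<le> \<bar>\<alpha> - (real_of_int r / real q - f (real_of_int p / real q))\<bar>"
      by (rule eventually_mono) (blast intro: near)
  qed
qed

text \<open>The null set comes from conditions on \<alpha> and the fractions alone, so it serves all
  of the uncountably many \<open>x\<close> at once. The Lipschitz interval reaches to
  \<open>K + 1\<close> because \<open>p/q\<close> may lie up to 1 away from
  \<open>x\<close>.\<close>

lemma AE_finite_simultaneous_approximations:
  fixes f :: "real \<Rightarrow> real" and \<tau> K L :: real
  assumes "3 < \<tau>" and "0 \<le> K" and lip: "L-lipschitz_on {-(K+1)..K+1} f"
  shows "AE \<alpha> in lborel. \<bar>\<alpha>\<bar> \<le> K \<longrightarrow> (\<forall>x. \<bar>x\<bar> \<le> K \<longrightarrow>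
    finite {(p :: int, r :: int, q :: int). q \<ge> 1 \<and>
      \<bar>x - real_of_int p / real_of_int q\<bar> < 1 / real_of_int q powr \<tau> \<and>
      \<bar>f x + \<alpha> - real_of_int r / real_of_int q\<bar> < 1 / real_of_int q powr \<tau>})"
proof -
  have L: "0 \<le> L" using lip by (rule lipschitz_on_nonneg)
  have f_bound: "\<bar>f x\<bar> \<le> \<bar>f 0\<bar> + L * K" if "\<bar>x\<bar> \<le> K" for x
  proof -
    have "\<bar>f x - f 0\<bar> \<le> L * \<bar>x - 0\<bar>"
      using lipschitz_onD[OF lip, of x 0] that \<open>0 \<le> K\<close> by (simp add: dist_real_def abs_le_iff)
    also have "\<dots> \<le> L * K" using that L by (intro mult_left_mono) auto
    finally show ?thesis by linarith
  qed
  define B where "B = \<bar>f 0\<bar> + L * K"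
  \<comment> \<open>One bound for both fractions: \<open>p/q\<close> is at most \<open>K + 1\<close>
    and \<open>r/q\<close> at most \<open>K + 1 + B\<close> in absolute value.\<close>
  obtain M :: nat where M: "K + 1 + B \<le> real M" using real_arch_simple by blast
  have "0 \<le> B" using L \<open>0 \<le> K\<close> by (simp add: B_def)
  then have "1 \<le> M" using M \<open>0 \<le> K\<close> by linarith
  \<comment> \<open>In the constant \<open>L + 1\<close>, the \<open>L\<close> is the cost of
    replacing \<open>f x\<close> by \<open>f (p/q)\<close>, and the 1 comes from the approximation
    by \<open>r/q\<close>.\<close>
  have solution: "\<bar>p\<bar> \<le> int M * q \<and> \<bar>r\<bar> \<le> int M * q \<and>
      \<bar>\<alpha> - (real_of_int r / real_of_int q - f (real_of_int p / real_of_int q))\<bar>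
        < (L + 1) * real_of_int q powr - \<tau>"
    if q: "q \<ge> 1" and \<alpha>: "\<bar>\<alpha>\<bar> \<le> K" and x: "\<bar>x\<bar> \<le> K"
      and p: "\<bar>x - real_of_int p / real_of_int q\<bar> < 1 / real_of_int q powr \<tau>"
      and r: "\<bar>f x + \<alpha> - real_of_int r / real_of_int q\<bar> < 1 / real_of_int q powr \<tau>"
    for \<alpha> x and p q r :: int
  proof -
    have "1 \<le> real_of_int q powr \<tau>"
      using q assms(1) by (intro ge_one_powr_ge_zero) auto
    then have le1: "1 / real_of_int q powr \<tau> \<le> 1" using q by simp
    have p': "\<bar>real_of_int p / real_of_int q\<bar> \<le> K + 1"
      using p le1 x by linarith
    have r': "\<bar>real_of_int r / real_of_int q\<bar> \<le> K + 1 + B"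
      using r le1 \<alpha> f_bound[OF x] unfolding B_def by linarith
    have integer_bound: "\<bar>z\<bar> \<le> int M * q" if "\<bar>real_of_int z / real_of_int q\<bar> \<le> real M" for z
    proof -
      have "real_of_int \<bar>z\<bar> \<le> real_of_int (int M * q)"
        using that q by (simp add: abs_divide pos_divide_le_eq)
      then show ?thesis by (simp only: of_int_le_iff)
    qed
    have "\<bar>f x - f (real_of_int p / real_of_int q)\<bar> \<le> L * \<bar>x - real_of_int p / real_of_int q\<bar>"
      using lipschitz_onD[OF lip, of x "real_of_int p / real_of_int q"] x p'
      unfolding dist_real_def abs_le_iff[of x] abs_le_iff[of "real_of_int p / real_of_int q"] by auto
    also have "\<dots> \<le> L * (1 / real_of_int q powr \<tau>)"
      using p L by (intro mult_left_mono) auto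
    finally have "\<bar>\<alpha> - (real_of_int r / real_of_int q - f (real_of_int p / real_of_int q))\<bar>
        < L * (1 / real_of_int q powr \<tau>) + 1 / real_of_int q powr \<tau>"
      using r by linarith
    then have "\<bar>\<alpha> - (real_of_int r / real_of_int q - f (real_of_int p / real_of_int q))\<bar>
        < (L + 1) * real_of_int q powr - \<tau>"
      by (simp add: powr_minus_divide algebra_simps add_divide_distrib)
    then show ?thesis
      using integer_bound p' r' M \<open>0 \<le> B\<close> by force
  qed
  have "AE \<alpha> in lborel. \<forall>\<^sub>F q :: nat in sequentially.
      \<forall>p\<in>{- int (M * q)..int (M * q)}. \<forall>r\<in>{- int (M * q)..int (M * q)}.
        (L + 1) * real q powr - \<tau>
          \<le> \<bar>\<alpha> - (real_of_int r / real q - f (real_of_int p / real q))\<bar>"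
    using assms(1) \<open>1 \<le> M\<close> L by (intro AE_eventually_not_near_lattice_differences) auto
  then show ?thesis
  proof (rule AE_mp, intro AE_I2 impI allI)
    fix \<alpha> x :: real
    assume ev: "\<forall>\<^sub>F q :: nat in sequentially.
      \<forall>p\<in>{- int (M * q)..int (M * q)}. \<forall>r\<in>{- int (M * q)..int (M * q)}.
        (L + 1) * real q powr - \<tau>
          \<le> \<bar>\<alpha> - (real_of_int r / real q - f (real_of_int p / real q))\<bar>"
      and \<alpha>: "\<bar>\<alpha>\<bar> \<le> K" and x: "\<bar>x\<bar> \<le> K"
    obtain Q :: nat where Q: "\<And>q p r. Q \<le> q \<Longrightarrow> p \<in> {- int (M * q)..int (M * q)} \<Longrightarrow>
        r \<in> {- int (M * q)..int (M * q)} \<Longrightarrow> (L + 1) * real q powr - \<tau>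
          \<le> \<bar>\<alpha> - (real_of_int r / real q - f (real_of_int p / real q))\<bar>"
      using ev unfolding eventually_sequentially by blast
    let ?J = "{- (int M * int Q)..int M * int Q}"
    have "{(p, r, q). q \<ge> 1 \<and>
        \<bar>x - real_of_int p / real_of_int q\<bar> < 1 / real_of_int q powr \<tau> \<and>
        \<bar>f x + \<alpha> - real_of_int r / real_of_int q\<bar> < 1 / real_of_int q powr \<tau>}
      \<subseteq> ?J \<times> ?J \<times> {1..int Q}"
    proof safe
      fix p r q :: int
      assume q: "q \<ge> 1"
        and "\<bar>x - real_of_int p / real_of_int q\<bar> < 1 / real_of_int q powr \<tau>"
        and "\<bar>f x + \<alpha> - real_of_int r / real_of_int q\<bar> < 1 / real_of_int q powr \<tau>"
      note sol = solution[OF q \<alpha> x this(2,3)]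
      \<comment> \<open>From \<open>Q\<close> on, the lower bound contradicts the strict upper bound
        in \<open>sol\<close>. With \<open>q\<close> bounded, \<open>p\<close> and \<open>r\<close>
        are bounded as well, leaving a finite box.\<close>
      have "q < int Q"
      proof (rule ccontr)
        assume "\<not> q < int Q"
        then have "Q \<le> nat q" by linarith
        then show False
          using Q[of "nat q" p r] sol q by (simp add: abs_le_iff)
      qed
      then have "int M * q \<le> int M * int Q" by (intro mult_left_mono) auto
      with sol \<open>q < int Q\<close> q
      show "p \<in> ?J" "r \<in> ?J" "q \<in> {1..int Q}" by auto
    qed
    then show "finite {(p, r, q). q \<ge> 1 \<and>
        \<bar>x - real_of_int p / real_of_int q\<bar> < 1 / real_of_int q powr \<tau> \<and>
        \<bar>f x + \<alpha> - real_of_int r / real_of_int q\<bar> < 1 / real_of_int q powr \<tau>}"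
      by (rule finite_subset) auto
  qed
qed

text \<open>The derivative is continuous, hence bounded on the compact interval, and such a bound is
  a Lipschitz constant.\<close>

lemma poly_lipschitz_on_Icc:
  fixes p :: "real poly"
  obtains L where "L-lipschitz_on {a..b} (poly p)"
proof -
  have "bounded (poly (pderiv p) ` {a..b})"
    by (intro compact_imp_bounded compact_continuous_image continuous_intros) auto
  then obtain L where L: "\<And>x. x \<in> {a..b} \<Longrightarrow> \<bar>poly (pderiv p) x\<bar> \<le> L" and "0 \<le> L"
    unfolding bounded_pos by fastforce
  have "L-lipschitz_on {a..b} (poly p)"
  proof (rule bounded_derivative_imp_lipschitz)
    show "(poly p has_derivative (*) (poly (pderiv p) x)) (at x within {a..b})" for x
      using has_field_derivative_at_within[OF poly_DERIV, of p x "{a..b}"]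
      by (simp add: has_field_derivative_def)
    show "onorm ((*) (poly (pderiv p) x)) \<le> L" if "x \<in> {a..b}" for x
      using L[OF that] by (intro onorm_le) (auto simp: abs_mult intro: mult_right_mono)
  qed (use \<open>0 \<le> L\<close> in auto)
  then show thesis by (rule that)
qed

theorem theorem1p4:
  fixes P :: "int poly" and d :: nat and \<tau> :: real
  assumes "degree P = d" and "d \<ge> 2" and "\<tau> > real d + 1"
  shows "AE \<alpha> in (lebesgue :: real measure). W \<tau> P \<alpha> = {}"
proof -
  \<comment> \<open>The degree enters through this inequality, the convergence condition for the
    Borel-Cantelli series.\<close>
  have "3 < \<tau>" using assms by linarith
  let ?f = "poly (map_poly real_of_int P)"
  let ?S = "\<lambda>\<alpha> x. {(p :: int, r :: int, q :: int). q \<ge> 1 \<and>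
      \<bar>x - real_of_int p / real_of_int q\<bar> < 1 / real_of_int q powr \<tau> \<and>
      \<bar>?f x + \<alpha> - real_of_int r / real_of_int q\<bar> < 1 / real_of_int q powr \<tau>}"
  \<comment> \<open>The Lipschitz constant, and with it the null set, depends on \<open>K\<close>.
    Taking \<open>K\<close> in the naturals leaves a countable union of null sets, which covers all
    \<alpha> and \<open>x\<close>.\<close>
  have "AE \<alpha> in lborel. \<bar>\<alpha>\<bar> \<le> real K \<longrightarrow> (\<forall>x. \<bar>x\<bar> \<le> real K \<longrightarrow> finite (?S \<alpha> x))" for K :: nat
  proof -
    obtain L where "L-lipschitz_on {-(real K + 1)..real K + 1} ?f"
      by (rule poly_lipschitz_on_Icc)
    with \<open>3 < \<tau>\<close> show ?thesis by (intro AE_finite_simultaneous_approximations) auto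
  qed
  then have "AE \<alpha> in lborel. \<forall>K :: nat.
      \<bar>\<alpha>\<bar> \<le> real K \<longrightarrow> (\<forall>x. \<bar>x\<bar> \<le> real K \<longrightarrow> finite (?S \<alpha> x))"
    unfolding AE_all_countable by blast
  then have "AE \<alpha> in lborel. W \<tau> P \<alpha> = {}"
  proof (rule AE_mp, intro AE_I2 impI)
    fix \<alpha> :: real
    assume *: "\<forall>K :: nat. \<bar>\<alpha>\<bar> \<le> real K \<longrightarrow> (\<forall>x. \<bar>x\<bar> \<le> real K \<longrightarrow> finite (?S \<alpha> x))"
    have "finite (?S \<alpha> x)" for x
    proof -
      obtain K :: nat where "max \<bar>\<alpha>\<bar> \<bar>x\<bar> \<le> real K" using real_arch_simple by blast
      then have "\<bar>\<alpha>\<bar> \<le> real K" and "\<bar>x\<bar> \<le> real K" by simp_all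
      then show ?thesis using * by blast
    qed
    then show "W \<tau> P \<alpha> = {}" unfolding W_def by blast
  qed
  \<comment> \<open>\<open>lebesgue\<close> is the completion of \<open>lborel\<close>, so null sets
    remain null.\<close>
  then show ?thesis by (rule AE_completion)
qed

end
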